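(* Let $S_1:\mathbb{R}^n\rightrightarrows\mathbb{R}^m$ and $S_2:\mathbb{R}^m\rightrightarrows\mathbb{R}^s$ be outer semicontinuous and $S=S_2\circ S_1$. Let $\bar x\in\mathrm{dom}\,S$, $\bar u\in S(\bar x)$, and let $(h,l)\in\mathbb{R}^n\times\mathbb{R}^s$. Let $\Xi(x,u)=\{w\in S_1(x)\mid u\in S_2(w)\}$. Assume that (a) there is a directional neighborhood $\mathcal{U}$ of $(h,l)$ such that $\Xi((\bar x,\bar u)+\mathcal{U})$ is bounded; (b) the mapping $F(x,w,u)=\big(\mathrm{gph}\,S_1-(x,w)\big)\times\big(\mathrm{gph}\,S_2-(w,u)\big)$ is metrically subregular at $((\bar x,w,\bar u),(0,0))$ for all $w\in\Xi(\bar x,\bar u)$ in all directions $(h,k,l)$ with $k$ such that $(h,k)\in T_{\mathrm{gph}\,S_1}(\bar x,w)$ and $(k,l)\in T_{\mathrm{gph}\,S_2}(w,\bar u)$, and in all directions $(0,k,0)$ with $k\in\mathbb{S}$ such that $(0,k)\in T_{\mathrm{gph}\,S_1}(\bar x,w)$ and $(k,0)\in T_{\mathrm{gph}\,S_2}(w,\bar u)$. Then for every $u^*\in\mathbb{R}^s$ the set $D^*S((\bar x,\bar u);(h,l))(u^* )$ is contained in $$\bigcup_{\tilde w\in\Xi(\bar x,\bar u)}\Big(\bigcup_{\substack{k\in DS_1(\bar x,\tilde w)(h)\\ l\in DS_2(\tilde w,\bar u)(k)}}D^*S_1((\bar x,\tilde w);(h,k))\circ D^*S_2((\tilde w,\bar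 u);(k,l))(u^* )\ \cup\bigcup_{\substack{k\in\mathbb{S},\ k\in DS_1(\bar x,\tilde w)(0)\\ 0\in DS_2(\tilde w,\bar u)(k)}}D^*S_1((\bar x,\tilde w);(0,k))\circ D^*S_2((\tilde w,\bar u);(k,0))(u^* )\Big).$$
   Context: Euclidean norms are used; $\mathbb{S}$ is the unit sphere (here of $\mathbb{R}^m$) and $\mathbb{B}$ the closed unit ball; $t_k\downarrow0$ means $t_k>0$, $t_k\to0$; $d_A(x)$ is the distance from $x$ to $A$ ($d_\emptyset=\infty$). Outer semicontinuous means having a closed graph. $(S_2\circ S_1)(x)=\bigcup_{w\in S_1(x)}S_2(w)$; compositions of coderivatives are understood in the same way, i.e. $(D^*S_1\circ D^*S_2)(u^* )=\bigcup_{w^*\in D^*S_2(u^* )}D^*S_1(w^* )$. $\mathrm{dom}\,S=\{x\mid S(x)\neq\emptyset\}$. For a set $\Omega$ and $x\in\Omega$: $T_\Omega(x)=\{u\mid\exists u_k\to u,\ t_k\downarrow0:\ x+t_ku_k\in\Omega\ \forall k\}$; $\hat N_\Omega(x)=\{\xi\mid\limsup_{x'\to x,\,x'\in\Omega}\langle\xi,x'-x\rangle/\|x'-x\|\le0\}$; both are empty if $x\notin\Omega$. The limiting normal cone in direction $u$ is $N_\Omega(x;u)=\{\xi\mid\exists t_k\downarrow0,\ u_k\to u,\ \xi_k\to\xi:\ \xi_k\in\hat N_\Omega(x+t_ku_k)\ \forall k\}$. For a multifunction $M$ and $(x,y)\in\mathrm{gph}\,M$: $DM(x,y)(u)=\{v\mid(u,v)\in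 T_{\mathrm{gph}\,M}(x,y)\}$; $D^*M((x,y);(u,v))(\eta)=\{\xi\mid(\xi,-\eta)\in N_{\mathrm{gph}\,M}((x,y);(u,v))\}$. A directional neighborhood of $u$ is a set containing $\mathcal{V}_{\rho,\delta}(u):=\{z\in\rho\mathbb{B}\mid\big\|\|u\|z-\|z\|u\big\|\le\delta\|z\|\|u\|\}$ for some $\rho,\delta>0$. A multifunction $F$ is metrically subregular at $(\bar z,\bar w)\in\mathrm{gph}\,F$ in direction $u$ if there are $\kappa>0$ and a directional neighborhood $\mathcal{U}$ of $u$ with $d_{F^{-1}(\bar w)}(z)\le\kappa\,d_{F(z)}(\bar w)$ for all $z\in\bar z+\mathcal{U}$. *)

theory Defs
  imports "HOL-Analysis.Analysis"
begin

text \<open>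
  A multifunction from \<open>'a\<close> to \<open>'b\<close> is a function of type \<open>'a \<Rightarrow> 'b set\<close>.
  The norm on product types is the Euclidean one.
\<close>

definition gph :: "('a \<Rightarrow> 'b set) \<Rightarrow> ('a \<times> 'b) set" where
  "gph M = {(x, y). y \<in> M x}"

definition mdom :: "('a \<Rightarrow> 'b set) \<Rightarrow> 'a set" where
  "mdom M = {x. M x \<noteq> {}}"

definition minv :: "('a \<Rightarrow> 'b set) \<Rightarrow> 'b \<Rightarrow> 'a set" where
  "minv M y = {x. y \<in> M x}"

definition mcomp :: "('b \<Rightarrow> 'c set) \<Rightarrow> ('a \<Rightarrow> 'b set) \<Rightarrow> 'a \<Rightarrow> 'c set"  (infixl "\<circ>\<^sub>m" 55) where
  "(S2 \<circ>\<^sub>m S1) x = (\<Union>w\<in>S1 x. S2 w)"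

definition outer_semicontinuous ::
  "('a::topological_space \<Rightarrow> 'b::topological_space set) \<Rightarrow> bool" where
  "outer_semicontinuous M \<longleftrightarrow> closed (gph M)"

text \<open>
  Extended-valued distance: \<^const>\<open>infdist\<close> gives \<open>0\<close> for the empty set, where
  the convention needed here is \<open>\<infinity>\<close>.
\<close>

definition edist_set :: "'a::metric_space set \<Rightarrow> 'a \<Rightarrow> ereal" where
  "edist_set A x = (if A = {} then \<infinity> else ereal (infdist x A))"

definition tangent_cone :: "'a::real_normed_vector set \<Rightarrow> 'a \<Rightarrow> 'a set" where
  "tangent_cone \<Omega> x = {u. x \<in> \<Omega> \<and>
     (\<exists>(t :: nat \<Rightarrow> real) (u' :: nat \<Rightarrow> 'a).
        (\<forall>k. t k > 0) \<and> t \<longlonglongrightarrow> 0 \<and> u' \<longlonglongrightarrow> u \<and> (\<forall>k. x + t k *\<^sub>R u' k \<in> \<Omega>))}"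

text \<open>
  If \<open>x\<close> is an isolated point of \<open>\<Omega>\<close>, the filter is trivial, the upper limit is
  \<open>-\<infinity>\<close>, and every vector is a regular normal.
\<close>

definition regular_normal_cone :: "'a::real_inner set \<Rightarrow> 'a \<Rightarrow> 'a set" where
  "regular_normal_cone \<Omega> x = {\<xi>. x \<in> \<Omega> \<and>
     Limsup (at x within \<Omega>) (\<lambda>x'. ereal ((\<xi> \<bullet> (x' - x)) / norm (x' - x))) \<le> 0}"

definition dir_normal_cone :: "'a::real_inner set \<Rightarrow> 'a \<Rightarrow> 'a \<Rightarrow> 'a set" where
  "dir_normal_cone \<Omega> x u = {\<xi>.
     \<exists>(t :: nat \<Rightarrow> real) (u' :: nat \<Rightarrow> 'a) (\<xi>' :: nat \<Rightarrow> 'a).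
        (\<forall>k. t k > 0) \<and> t \<longlonglongrightarrow> 0 \<and> u' \<longlonglongrightarrow> u \<and> \<xi>' \<longlonglongrightarrow> \<xi> \<and>
        (\<forall>k. \<xi>' k \<in> regular_normal_cone \<Omega> (x + t k *\<^sub>R u' k))}"

definition graph_deriv ::
  "('a::real_normed_vector \<Rightarrow> 'b::real_normed_vector set) \<Rightarrow> 'a \<times> 'b \<Rightarrow> 'a \<Rightarrow> 'b set" where
  "graph_deriv M p u = {v. (u, v) \<in> tangent_cone (gph M) p}"

definition dir_coderiv ::
  "('a::real_inner \<Rightarrow> 'b::real_inner set) \<Rightarrow> 'a \<times> 'b \<Rightarrow> 'a \<times> 'b \<Rightarrow> 'b \<Rightarrow> 'a set" where
  "dir_coderiv M p d \<eta> = {\<xi>. (\<xi>, - \<eta>) \<in> dir_normal_cone (gph M) p d}"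

definition dir_nbhd_base :: "real \<Rightarrow> real \<Rightarrow> 'a::real_normed_vector \<Rightarrow> 'a set" where
  "dir_nbhd_base \<rho> \<delta> u =
     {z \<in> cball 0 \<rho>. norm (norm u *\<^sub>R z - norm z *\<^sub>R u) \<le> \<delta> * norm z * norm u}"

definition dir_nbhd :: "'a::real_normed_vector \<Rightarrow> 'a set \<Rightarrow> bool" where
  "dir_nbhd u U \<longleftrightarrow> (\<exists>\<rho>>0. \<exists>\<delta>>0. dir_nbhd_base \<rho> \<delta> u \<subseteq> U)"

definition metrically_subregular_dir ::
  "('a::real_normed_vector \<Rightarrow> 'b::metric_space set) \<Rightarrow> 'a \<times> 'b \<Rightarrow> 'a \<Rightarrow> bool" where
  "metrically_subregular_dir F p u \<longleftrightarrow> p \<in> gph F \<and>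
     (\<exists>(\<kappa>::real) U. \<kappa> > 0 \<and> dir_nbhd u U \<and>
        (\<forall>z \<in> (+) (fst p) ` U.
           edist_set (minv F (snd p)) z \<le> ereal \<kappa> * edist_set (F z) (snd p)))"

definition intermediate ::
  "('a \<Rightarrow> 'b set) \<Rightarrow> ('b \<Rightarrow> 'c set) \<Rightarrow> 'a \<times> 'c \<Rightarrow> 'b set"  ("\<Xi>") where
  "\<Xi> S1 S2 = (\<lambda>(x, u). {w \<in> S1 x. u \<in> S2 w})"

definition chain_map ::
  "('a::ab_group_add \<Rightarrow> 'b::ab_group_add set) \<Rightarrow> ('b \<Rightarrow> 'c::ab_group_add set)
     \<Rightarrow> 'a \<times> 'b \<times> 'c \<Rightarrow> (('a \<times> 'b) \<times> ('b \<times> 'c)) set" where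
  "chain_map S1 S2 = (\<lambda>(x, w, u).
     ((\<lambda>p. p - (x, w)) ` gph S1) \<times> ((\<lambda>q. q - (w, u)) ` gph S2))"

end

theory Submission
  imports Defs
begin

text \<open>
  The graph of \<open>S\<close> is the projection along \<open>w\<close> of the set \<open>C\<close> of all triples
  \<open>(x, w, u)\<close> with \<open>(x, w) \<in> gph S1\<close> and \<open>(w, u) \<in> gph S2\<close>. Projecting only shortens
  distances, so a regular normal \<open>(\<xi>, \<eta>)\<close> of \<open>gph S\<close> lifts to the regular normal
  \<open>(\<xi>, 0, \<eta>)\<close> of \<open>C\<close> at every triple above the base point
  (\<open>regular_normal_mcomp_imp_chain_set\<close>). Since \<open>C\<close> is the zero set of the mapping \<open>F\<close>
  of assumption (b), what remains is a directional intersection rule for \<open>C\<close>.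

  \<^bold>\<open>The direction of the lifted points.\<close> A directional limiting normal of \<open>gph S\<close> is witnessed
  by points \<open>(x\<^sub>k, u\<^sub>k) = (xb, ub) + t\<^sub>k (h\<^sub>k, l\<^sub>k)\<close>. Intermediate points
  \<open>w\<^sub>k\<close> are bounded by (a), hence accumulate at some \<open>w\<close>, and closedness of the graphs puts
  \<open>w\<close> into \<open>\<Xi>(xb, ub)\<close>. Rescaling by \<open>\<tau>\<^sub>k = max t\<^sub>k \<bar>w\<^sub>k - w\<bar>\<close> gives bounded difference
  quotients, so along a subsequence \<open>t\<^sub>k / \<tau>\<^sub>k \<longlonglongrightarrow> L\<close> and
  \<open>(w\<^sub>k - w) / \<tau>\<^sub>k \<longlonglongrightarrow> e\<close> with \<open>max L \<bar>e\<bar> = 1\<close>. If \<open>L \<noteq> 0\<close>, then \<open>w\<^sub>k\<close>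
  approaches \<open>w\<close> at least at the speed \<open>t\<^sub>k\<close>, and the triples have the direction
  \<open>(h, e / L, l)\<close>; if \<open>L = 0\<close>, then \<open>w\<^sub>k\<close> converges more slowly, and they have the direction
  \<open>(0, e, 0)\<close> with a unit vector \<open>e\<close>. These are the two parts of the union.

  \<^bold>\<open>The intersection rule.\<close> A regular normal \<open>\<zeta>\<close> of \<open>C\<close> makes the base point a local minimum,
  up to \<open>\<epsilon>\<close>, of \<open>z \<mapsto> -\<zeta> \<bullet> z\<close> on \<open>C\<close>; since this function is Lipschitz, a multiple of the
  distance to \<open>C\<close> is an exact penalty (\<open>regular_normal_exact_penalty\<close>), and subregularity
  bounds that distance by the distances of \<open>(x, w)\<close> to \<open>gph S1\<close> and of \<open>(w, u)\<close> to \<open>gph S2\<close>.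
  In place of this exact penalty, the proof minimizes with a large multiple of the squared
  distances: the optimality condition then expresses \<open>\<zeta>\<close>, up to \<open>\<epsilon>\<close>, as a sum of projection
  residuals, which are regular normals of the two graphs, and the exact penalty bounds these
  residuals by a fixed multiple of \<open>\<bar>\<zeta>\<bar> + \<epsilon>\<close> (\<open>fuzzy_chain_multipliers\<close>). Points on the way to the limit
  are moved by \<open>o(\<tau>\<^sub>k)\<close> only, so a limit of the bounded multipliers consists of limiting normals
  in the same direction (\<open>directional_chain_normals\<close>).
\<close>

section \<open>Regular normals and exact penalization\<close>

lemma regular_normal_cone_iff:
  "\<xi> \<in> regular_normal_cone \<Omega> x \<longleftrightarrow>
     x \<in> \<Omega> \<and> (\<forall>\<epsilon>>0. \<exists>r>0. \<forall>z\<in>\<Omega>. dist z x < r \<longrightarrow> \<xi> \<bullet> (z - x) \<le> \<epsilon> * norm (z - x))"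
  (is "_ \<longleftrightarrow> _ \<and> ?R")
proof -
  let ?q = "\<lambda>z. (\<xi> \<bullet> (z - x)) / norm (z - x)"
  have "Limsup (at x within \<Omega>) (\<lambda>z. ereal (?q z)) \<le> 0 \<longleftrightarrow> ?R"
  proof
    assume L: "Limsup (at x within \<Omega>) (\<lambda>z. ereal (?q z)) \<le> 0"
    show ?R
    proof (intro allI impI)
      fix \<epsilon> :: real assume "\<epsilon> > 0"
      then have "\<forall>\<^sub>F z in at x within \<Omega>. ereal (?q z) < ereal \<epsilon>"
        using L unfolding Limsup_le_iff by (metis ereal_less(2))
      then obtain r where r: "r > 0"
        "\<And>z. z \<in> \<Omega> \<Longrightarrow> z \<noteq> x \<Longrightarrow> dist z x < r \<Longrightarrow> ?q z < \<epsilon>"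
        unfolding eventually_at by auto
      have "\<xi> \<bullet> (z - x) \<le> \<epsilon> * norm (z - x)" if "z \<in> \<Omega>" "dist z x < r" for z
      proof (cases "z = x")
        case False
        then show ?thesis using r(2)[of z] that by (simp add: field_simps)
      qed simp
      then show "\<exists>r>0. \<forall>z\<in>\<Omega>. dist z x < r \<longrightarrow> \<xi> \<bullet> (z - x) \<le> \<epsilon> * norm (z - x)"
        using r(1) by blast
    qed
  next
    assume R: ?R
    show "Limsup (at x within \<Omega>) (\<lambda>z. ereal (?q z)) \<le> 0"
      unfolding Limsup_le_iff
    proof (intro allI impI)
      fix y :: ereal assume "0 < y"
      then obtain e where e: "0 < ereal e" "ereal e < y"
        using ereal_dense2 by blast
      then obtain r where r: "r > 0"
        "\<And>z. z \<in> \<Omega> \<Longrightarrow> dist z x < r \<Longrightarrow> \<xi> \<bullet> (z - x) \<le> e * norm (z - x)"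
        using R by auto
      have "ereal (?q z) < y" if "z \<in> \<Omega>" "z \<noteq> x" "dist z x < r" for z
      proof -
        have "?q z \<le> e" using r(2)[of z] that by (simp add: field_simps)
        then show ?thesis using e(2) by (meson ereal_less_eq(3) le_less_trans)
      qed
      then show "\<forall>\<^sub>F z in at x within \<Omega>. ereal (?q z) < y"
        unfolding eventually_at using r(1) by blast
    qed
  qed
  then show ?thesis unfolding regular_normal_cone_def by auto
qed

text \<open>
  A point of \<open>\<Omega>\<close> near \<open>p\<close> is no closer to \<open>y\<close> than \<open>p\<close> is, and expanding the squares turns this
  into \<open>2 (y - p) \<bullet> (z - p) \<le> \<bar>z - p\<bar>\<^sup>2\<close>, a bound of second order.
\<close>

lemma projection_residual_regular_normal:
  assumes p: "p \<in> \<Omega>" and dist: "infdist y \<Omega> = dist y p" and K: "K \<ge> 0"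
  shows "K *\<^sub>R (y - p) \<in> regular_normal_cone \<Omega> p"
  unfolding regular_normal_cone_iff
proof (intro conjI allI impI)
  fix \<epsilon> :: real assume \<epsilon>: "\<epsilon> > 0"
  define r where "r = \<epsilon> / (K + 1)"
  have r: "r > 0" using \<epsilon> K by (simp add: r_def)
  have "(K *\<^sub>R (y - p)) \<bullet> (z - p) \<le> \<epsilon> * norm (z - p)" if z: "z \<in> \<Omega>" "dist z p < r" for z
  proof -
    have "norm (y - p) \<le> norm (y - z)"
      using infdist_le[OF z(1), of y] dist by (simp add: dist_norm)
    then have "(norm (y - p))\<^sup>2 \<le> (norm (y - z))\<^sup>2" by (simp add: power_mono)
    also have "y - z = (y - p) - (z - p)" by simp
    also have "(norm ((y - p) - (z - p)))\<^sup>2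
        = (norm (y - p))\<^sup>2 - 2 * ((y - p) \<bullet> (z - p)) + (norm (z - p))\<^sup>2"
      by (simp add: power2_norm_eq_inner inner_diff_left inner_diff_right inner_commute algebra_simps)
    finally have "2 * ((y - p) \<bullet> (z - p)) \<le> (norm (z - p))\<^sup>2" by simp
    then have "(y - p) \<bullet> (z - p) \<le> (norm (z - p))\<^sup>2"
      using zero_le_power2[of "norm (z - p)"] by linarith
    then have "K * ((y - p) \<bullet> (z - p)) \<le> K * (norm (z - p))\<^sup>2"
      using K by (rule mult_left_mono)
    also have "\<dots> = (K * norm (z - p)) * norm (z - p)" by (simp add: power2_eq_square)
    also have "\<dots> \<le> \<epsilon> * norm (z - p)"
    proof (rule mult_right_mono)
      have "K * norm (z - p) \<le> (K + 1) * r"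
        using z(2) K by (intro mult_mono) (auto simp: dist_norm)
      also have "\<dots> = \<epsilon>" using K by (simp add: r_def)
      finally show "K * norm (z - p) \<le> \<epsilon>" .
    qed simp
    finally show ?thesis by simp
  qed
  then show "\<exists>r>0. \<forall>z\<in>\<Omega>. dist z p < r \<longrightarrow> (K *\<^sub>R (y - p)) \<bullet> (z - p) \<le> \<epsilon> * norm (z - p)"
    using r by blast
qed (rule p)

text \<open>
  For \<open>z\<close> off \<open>\<Omega>\<close>, compare with its projection \<open>c\<close>: the normal inequality holds at \<open>c\<close>, and moving
  from \<open>c\<close> to \<open>z\<close> costs at most \<open>\<bar>\<zeta>\<bar> + \<epsilon>\<close> times the distance.
\<close>

lemma regular_normal_exact_penalty:
  fixes \<Omega> :: "'a::{real_inner, heine_borel} set"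
  assumes cl: "closed \<Omega>" and \<zeta>: "\<zeta> \<in> regular_normal_cone \<Omega> z0" and \<epsilon>: "\<epsilon> > 0"
  obtains r where "r > 0"
    "\<And>z. dist z z0 < r \<Longrightarrow>
       \<zeta> \<bullet> (z - z0) \<le> \<epsilon> * norm (z - z0) + (norm \<zeta> + \<epsilon>) * infdist z \<Omega>"
proof -
  from \<zeta> have z0: "z0 \<in> \<Omega>" by (simp add: regular_normal_cone_iff)
  from \<zeta> \<epsilon> obtain r where r: "r > 0"
    "\<And>z. z \<in> \<Omega> \<Longrightarrow> dist z z0 < r \<Longrightarrow> \<zeta> \<bullet> (z - z0) \<le> \<epsilon> * norm (z - z0)"
    unfolding regular_normal_cone_iff by blast
  show thesis
  proof (rule that[of "r / 2"])
    fix z assume z: "dist z z0 < r / 2"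
    obtain c where c: "c \<in> \<Omega>" "infdist z \<Omega> = dist z c"
      using infdist_attains_inf[OF cl] z0 by blast
    have "dist z c \<le> dist z z0" using infdist_le[OF z0, of z] c(2) by simp
    then have "dist c z0 < r" using z dist_triangle[of c z0 z] by (simp add: dist_commute)
    then have 1: "\<zeta> \<bullet> (c - z0) \<le> \<epsilon> * norm (c - z0)" using r(2) c(1) by blast
    have "norm (c - z0) \<le> norm (z - z0) + norm (z - c)"
      using norm_triangle_ineq4[of "z - z0" "z - c"] by simp
    then have "\<epsilon> * norm (c - z0) \<le> \<epsilon> * (norm (z - z0) + norm (z - c))"
      using \<epsilon> by (intro mult_left_mono) auto
    moreover have "\<zeta> \<bullet> (z - c) \<le> norm \<zeta> * norm (z - c)" by (rule norm_cauchy_schwarz)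
    moreover have "\<zeta> \<bullet> (z - z0) = \<zeta> \<bullet> (c - z0) + \<zeta> \<bullet> (z - c)"
      by (simp add: inner_diff_right)
    ultimately show "\<zeta> \<bullet> (z - z0) \<le> \<epsilon> * norm (z - z0) + (norm \<zeta> + \<epsilon>) * infdist z \<Omega>"
      using 1 by (simp add: c(2) dist_norm algebra_simps)
  qed (use r(1) in simp)
qed

section \<open>Approximate multipliers for chained sets\<close>

text \<open>The set \<open>F\<^sup>-\<^sup>1(0)\<close> of the mapping \<open>F\<close>, in terms of the two graphs.\<close>

definition chain_set :: "('a \<times> 'b) set \<Rightarrow> ('b \<times> 'c) set \<Rightarrow> ('a \<times> 'b \<times> 'c) set" where
  "chain_set A B = {(x, w, u). (x, w) \<in> A \<and> (w, u) \<in> B}"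

lemma mem_chain_set: "(x, w, u) \<in> chain_set A B \<longleftrightarrow> (x, w) \<in> A \<and> (w, u) \<in> B"
  by (simp add: chain_set_def)

lemma closed_chain_set:
  fixes A :: "('a::metric_space \<times> 'b::metric_space) set" and B :: "('b \<times> 'c::metric_space) set"
  assumes "closed A" "closed B"
  shows "closed (chain_set A B)"
proof -
  have "chain_set A B = (\<lambda>z. (fst z, fst (snd z))) -` A \<inter> snd -` B"
    by (auto simp: chain_set_def)
  then show ?thesis
    using assms by (auto intro!: closed_Int closed_vimage continuous_intros)
qed

text \<open>
  The first-order condition at a minimum of an \<open>\<epsilon>\<close>-Lipschitz function plus a smooth one:
  stepping by \<open>t\<close> along the negative gradient \<open>v\<close> of the smooth part gains \<open>t \<bar>v\<bar>\<^sup>2\<close> and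
  loses at most \<open>\<epsilon> t \<bar>v\<bar>\<close>, up to second order.
\<close>

lemma norm_le_of_perturbed_minimum:
  fixes v :: "'a::real_inner"
  assumes t0: "t0 > 0"
    and le: "\<And>t. 0 < t \<Longrightarrow> t < t0 \<Longrightarrow> t * (v \<bullet> v) \<le> \<epsilon> * (t * norm v) + t\<^sup>2 * b"
    and \<epsilon>: "\<epsilon> \<ge> 0"
  shows "norm v \<le> \<epsilon>"
proof -
  have "((\<lambda>t. \<epsilon> * norm v + t * b) \<longlongrightarrow> \<epsilon> * norm v + 0 * b) (at_right 0)"
    by (intro tendsto_intros)
  moreover have "\<forall>\<^sub>F t in at_right 0. v \<bullet> v \<le> \<epsilon> * norm v + t * b"
  proof -
    have "v \<bullet> v \<le> \<epsilon> * norm v + t * b" if "0 < t" "t < t0" for t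
    proof -
      have "t * (v \<bullet> v) \<le> t * (\<epsilon> * norm v + t * b)"
        using le[OF that] by (simp add: algebra_simps power2_eq_square)
      then show ?thesis using that(1) by simp
    qed
    then show ?thesis using eventually_at_right_real[OF t0] by (auto elim: eventually_mono)
  qed
  ultimately have "v \<bullet> v \<le> \<epsilon> * norm v + 0 * b"
    by (rule tendsto_lowerbound) simp
  then have "v \<bullet> v \<le> \<epsilon> * norm v" by simp
  then have "norm v * norm v \<le> \<epsilon> * norm v"
    by (simp add: power2_norm_eq_inner[symmetric] power2_eq_square)
  then show ?thesis using \<epsilon> by (cases "norm v = 0") auto
qed

text \<open>
  Minimize \<open>-\<zeta> \<bullet> (z - z0) + \<epsilon> \<bar>z - z0\<bar> + K/2 (dist\<^sub>A\<^sup>2 + dist\<^sub>B\<^sup>2)\<close> over a small ball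
  about \<open>z0 = (x0, w0, u0)\<close>. At the minimizer \<open>z\<close>, let \<open>s\<close> be the sum of the two distances. The
  value there is at most the value \<open>0\<close> at \<open>z0\<close>, while the exact penalty bounds the linear term
  from below by \<open>-\<epsilon>/2 \<bar>z - z0\<bar> - c s\<close>. Hence \<open>\<epsilon>/2 \<bar>z - z0\<bar> + K/4 s\<^sup>2 \<le> c s\<close>, so that \<open>K s \<le> 4 c\<close>
  bounds the multipliers for every \<open>K\<close>, and \<open>z \<longlonglongrightarrow> z0\<close> as \<open>K\<close> grows.
  The bound on \<open>\<alpha>\<close> and \<open>\<beta>\<close> depends on \<open>\<zeta>\<close>, \<open>\<kappa>\<close> and \<open>\<epsilon>\<close> but not on the radius \<open>r0\<close>, which shrinks
  when the lemma is applied along a sequence.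
\<close>

lemma fuzzy_chain_multipliers:
  fixes A :: "('a::euclidean_space \<times> 'b::euclidean_space) set"
    and B :: "('b \<times> 'c::euclidean_space) set"
  assumes clA: "closed A" and clB: "closed B"
    and \<zeta>: "\<zeta> \<in> regular_normal_cone (chain_set A B) (x0, w0, u0)"
    and \<kappa>: "\<kappa> > 0" and r0: "r0 > 0"
    and sub: "\<And>x w u p q. dist (x, w, u) (x0, w0, u0) < r0 \<Longrightarrow> p \<in> A \<Longrightarrow> q \<in> B \<Longrightarrow>
       infdist (x, w, u) (chain_set A B) \<le> \<kappa> * (dist (x, w) p + dist (w, u) q)"
    and \<epsilon>: "\<epsilon> > 0"
  obtains p q \<alpha> \<beta> where
    "dist p (x0, w0) \<le> \<epsilon>" "dist q (w0, u0) \<le> \<epsilon>"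
    "\<alpha> \<in> regular_normal_cone A p" "\<beta> \<in> regular_normal_cone B q"
    "norm \<alpha> \<le> 4 * \<kappa> * (norm \<zeta> + \<epsilon>)" "norm \<beta> \<le> 4 * \<kappa> * (norm \<zeta> + \<epsilon>)"
    "norm (\<zeta> - (fst \<alpha>, snd \<alpha> + fst \<beta>, snd \<beta>)) \<le> \<epsilon>"
proof -
  let ?C = "chain_set A B" and ?z0 = "(x0, w0, u0)"
  define c where "c = \<kappa> * (norm \<zeta> + \<epsilon>)"
  have c: "c > 0" using \<kappa> \<epsilon> by (simp add: c_def add_nonneg_pos)
  define P1 :: "'a \<times> 'b \<times> 'c \<Rightarrow> 'a \<times> 'b" where "P1 = (\<lambda>z. (fst z, fst (snd z)))"
  define P2 :: "'a \<times> 'b \<times> 'c \<Rightarrow> 'b \<times> 'c" where "P2 = snd"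
  have z0: "(x0, w0) \<in> A" "(w0, u0) \<in> B"
    using \<zeta> by (auto simp: regular_normal_cone_iff mem_chain_set)
  obtain r1 where r1: "r1 > 0"
    "\<And>z. dist z ?z0 < r1 \<Longrightarrow>
       \<zeta> \<bullet> (z - ?z0) \<le> \<epsilon> / 2 * norm (z - ?z0) + (norm \<zeta> + \<epsilon> / 2) * infdist z ?C"
    using regular_normal_exact_penalty[OF closed_chain_set[OF clA clB] \<zeta>, of "\<epsilon> / 2"] \<epsilon> by auto
  define r where "r = min r0 r1 / 2"
  have r: "r > 0" "r < r0" "r < r1" using r0 r1(1) by (auto simp: r_def)
  have pen: "\<zeta> \<bullet> (z - ?z0) \<le> \<epsilon> / 2 * norm (z - ?z0) + c * (dist (P1 z) p + dist (P2 z) q)"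
    if "dist z ?z0 \<le> r" "p \<in> A" "q \<in> B" for z p q
  proof -
    have "infdist z ?C \<le> \<kappa> * (dist (P1 z) p + dist (P2 z) q)"
      using sub[of "fst z" "fst (snd z)" "snd (snd z)" p q] that r(2) by (simp add: P1_def P2_def)
    then have "(norm \<zeta> + \<epsilon> / 2) * infdist z ?C
        \<le> (norm \<zeta> + \<epsilon>) * (\<kappa> * (dist (P1 z) p + dist (P2 z) q))"
      using \<epsilon> by (intro mult_mono) (auto simp: infdist_nonneg)
    also have "\<dots> = c * (dist (P1 z) p + dist (P2 z) q)" by (simp add: c_def)
    finally show ?thesis using r1(2)[of z] that(1) r(3) by linarith
  qed
  \<comment> \<open>\<open>K\<close> is chosen so large that \<open>s \<le> 4 c / K\<close> is below \<open>\<epsilon> / 2\<close> and that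
    \<open>\<epsilon> / 2 \<bar>z - z0\<bar> \<le> c s \<le> 4 c\<^sup>2 / K \<le> m\<close> keeps \<open>z\<close> in the interior of the ball and
    within \<open>\<epsilon> / 2\<close> of \<open>z0\<close>.\<close>
  define m where "m = \<epsilon> / 2 * min (r / 2) (\<epsilon> / 2)"
  have m: "m > 0" using \<epsilon> r(1) by (simp add: m_def)
  define K where "K = 4 * c\<^sup>2 / m + 8 * c / \<epsilon>"
  have K: "K > 0" using c m \<epsilon> by (simp add: K_def add_pos_pos)
  have K1: "4 * c\<^sup>2 / K \<le> m"
  proof -
    have "4 * c\<^sup>2 = m * (4 * c\<^sup>2 / m)" using m by simp
    also have "\<dots> \<le> m * K" using m c \<epsilon> by (intro mult_left_mono) (auto simp: K_def)
    finally show ?thesis using K by (simp add: field_simps)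
  qed
  have K2: "4 * c / K \<le> \<epsilon> / 2"
  proof -
    have "4 * c = \<epsilon> / 2 * (8 * c / \<epsilon>)" using \<epsilon> by simp
    also have "\<dots> \<le> \<epsilon> / 2 * K" using m c \<epsilon> by (intro mult_left_mono) (auto simp: K_def)
    finally show ?thesis using K by (simp add: field_simps)
  qed
  define f where "f = (\<lambda>z. - (\<zeta> \<bullet> (z - ?z0)) + \<epsilon> * norm (z - ?z0)
      + K / 2 * ((infdist (P1 z) A)\<^sup>2 + (infdist (P2 z) B)\<^sup>2))"
  have "continuous_on (cball ?z0 r) f"
    unfolding f_def P1_def P2_def by (intro continuous_intros)
  then obtain z where z: "z \<in> cball ?z0 r" and min: "\<And>y. y \<in> cball ?z0 r \<Longrightarrow> f z \<le> f y"
    using continuous_attains_inf[of "cball ?z0 r" f] r(1) by auto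
  obtain p where p: "p \<in> A" "infdist (P1 z) A = dist (P1 z) p"
    using infdist_attains_inf[OF clA] z0 by blast
  obtain q where q: "q \<in> B" "infdist (P2 z) B = dist (P2 z) q"
    using infdist_attains_inf[OF clB] z0 by blast
  define \<rho> where "\<rho> = dist (P1 z) p"
  define \<sigma> where "\<sigma> = dist (P2 z) q"
  have \<rho>\<sigma>: "\<rho> \<ge> 0" "\<sigma> \<ge> 0" by (auto simp: \<rho>_def \<sigma>_def)
  have "f ?z0 = 0" using z0 by (simp add: f_def P1_def P2_def)
  then have "f z \<le> 0" using min[of ?z0] r(1) by simp
  then have up: "- (\<zeta> \<bullet> (z - ?z0)) + \<epsilon> * norm (z - ?z0) + K / 2 * (\<rho>\<^sup>2 + \<sigma>\<^sup>2) \<le> 0"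
    by (simp add: f_def p(2) q(2) \<rho>_def \<sigma>_def)
  have "\<zeta> \<bullet> (z - ?z0) \<le> \<epsilon> / 2 * norm (z - ?z0) + c * (\<rho> + \<sigma>)"
    using pen[OF _ p(1) q(1), of z] z by (simp add: \<rho>_def \<sigma>_def dist_commute)
  with up have key: "\<epsilon> / 2 * norm (z - ?z0) + K / 2 * (\<rho>\<^sup>2 + \<sigma>\<^sup>2) \<le> c * (\<rho> + \<sigma>)"
    by (simp add: field_simps)
  have sq: "(\<rho> + \<sigma>)\<^sup>2 \<le> 2 * (\<rho>\<^sup>2 + \<sigma>\<^sup>2)"
    using zero_le_power2[of "\<rho> - \<sigma>"] by (simp add: power2_eq_square algebra_simps)
  have bd: "K * (\<rho> + \<sigma>) \<le> 4 * c"
  proof (cases "\<rho> + \<sigma> = 0")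
    case False
    have "K * (\<rho> + \<sigma>)\<^sup>2 \<le> K * (2 * (\<rho>\<^sup>2 + \<sigma>\<^sup>2))" using sq K by (intro mult_left_mono) auto
    also have "\<dots> = 4 * (K / 2 * (\<rho>\<^sup>2 + \<sigma>\<^sup>2))" by simp
    also have "K / 2 * (\<rho>\<^sup>2 + \<sigma>\<^sup>2) \<le> c * (\<rho> + \<sigma>)"
    proof -
      have "0 \<le> \<epsilon> / 2 * norm (z - ?z0)" using \<epsilon> by simp
      then show ?thesis using key by linarith
    qed
    finally have "(\<rho> + \<sigma>) * (K * (\<rho> + \<sigma>)) \<le> (\<rho> + \<sigma>) * (4 * c)"
      by (simp add: power2_eq_square algebra_simps)
    then show ?thesis using False \<rho>\<sigma> by (auto dest: mult_left_le_imp_le)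
  qed (use c in simp)
  have s: "\<rho> + \<sigma> \<le> \<epsilon> / 2"
  proof -
    have "\<rho> + \<sigma> \<le> 4 * c / K" using bd K by (simp add: field_simps)
    then show ?thesis using K2 by linarith
  qed
  have zz: "norm (z - ?z0) \<le> min (r / 2) (\<epsilon> / 2)"
  proof -
    have "\<epsilon> / 2 * norm (z - ?z0) \<le> c * (\<rho> + \<sigma>)"
    proof -
      have "0 \<le> K / 2 * (\<rho>\<^sup>2 + \<sigma>\<^sup>2)" using K by simp
      then show ?thesis using key by linarith
    qed
    also have "\<dots> \<le> c * (4 * c / K)"
      using bd K c by (intro mult_left_mono) (auto simp: field_simps)
    also have "\<dots> \<le> m" using K1 by (simp add: power2_eq_square mult.left_commute)
    finally show ?thesis using \<epsilon> by (simp add: m_def)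
  qed
  define \<alpha> where "\<alpha> = K *\<^sub>R (P1 z - p)"
  define \<beta> where "\<beta> = K *\<^sub>R (P2 z - q)"
  \<comment> \<open>With the projections \<open>p\<close> and \<open>q\<close> of the minimizer held fixed, \<open>z\<close> still minimizes, and the
    squared distances to fixed points are smooth, with total gradient \<open>G\<close>.\<close>
  define G where "G = (fst \<alpha>, snd \<alpha> + fst \<beta>, snd \<beta>)"
  have G: "G \<bullet> v = \<alpha> \<bullet> P1 v + \<beta> \<bullet> P2 v" for v
    by (cases v) (simp add: G_def P1_def P2_def inner_prod_def inner_add_left)
  define v where "v = \<zeta> - G"
  have "norm v \<le> \<epsilon>"
  proof (rule norm_le_of_perturbed_minimum)
    show "0 < (r / 2) / (norm v + 1)"
      using r(1) by (simp add: add_nonneg_pos)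
  next
    fix t :: real assume t: "0 < t" "t < (r / 2) / (norm v + 1)"
    let ?y = "z + t *\<^sub>R v"
    have pos: "0 < norm v + 1" by (simp add: add_nonneg_pos)
    have "t * norm v \<le> t * (norm v + 1)" using t by simp
    also have "\<dots> < r / 2" using t(2) unfolding pos_less_divide_eq[OF pos] .
    finally have tv: "t * norm v < r / 2" .
    have ny: "norm (?y - ?z0) \<le> norm (z - ?z0) + t * norm v"
      using norm_triangle_ineq[of "z - ?z0" "t *\<^sub>R v"] t by (simp add: add_diff_eq diff_add_eq)
    then have "norm (?y - ?z0) \<le> r" using tv zz by simp
    then have "?y \<in> cball ?z0 r" by (simp add: dist_norm norm_minus_commute)
    then have "f z \<le> f ?y" by (rule min)
    also have "f ?y \<le> - (\<zeta> \<bullet> (?y - ?z0)) + \<epsilon> * norm (?y - ?z0)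
      + K / 2 * ((dist (P1 ?y) p)\<^sup>2 + (dist (P2 ?y) q)\<^sup>2)"
      unfolding f_def using K \<epsilon> p(1) q(1)
      by (intro add_mono mult_left_mono power_mono infdist_le) (auto simp: infdist_nonneg)
    also have "(dist (P1 ?y) p)\<^sup>2 = \<rho>\<^sup>2 + 2 * t * ((P1 z - p) \<bullet> P1 v) + t\<^sup>2 * (P1 v \<bullet> P1 v)"
    proof -
      have "P1 ?y - p = (P1 z - p) + t *\<^sub>R P1 v" by (simp add: P1_def prod_eq_iff)
      then show ?thesis unfolding \<rho>_def dist_norm power2_norm_eq_inner
        by (simp add: inner_add_left inner_add_right inner_commute power2_eq_square algebra_simps)
    qed
    also have "(dist (P2 ?y) q)\<^sup>2 = \<sigma>\<^sup>2 + 2 * t * ((P2 z - q) \<bullet> P2 v) + t\<^sup>2 * (P2 v \<bullet> P2 v)"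
    proof -
      have "P2 ?y - q = (P2 z - q) + t *\<^sub>R P2 v" by (simp add: P2_def)
      then show ?thesis unfolding \<sigma>_def dist_norm power2_norm_eq_inner
        by (simp add: inner_add_left inner_add_right inner_commute power2_eq_square algebra_simps)
    qed
    also have "\<zeta> \<bullet> (?y - ?z0) = \<zeta> \<bullet> (z - ?z0) + t * (\<zeta> \<bullet> v)"
      by (simp add: inner_diff_right inner_add_right)
    also have "f z = - (\<zeta> \<bullet> (z - ?z0)) + \<epsilon> * norm (z - ?z0) + K / 2 * (\<rho>\<^sup>2 + \<sigma>\<^sup>2)"
      by (simp add: f_def p(2) q(2) \<rho>_def \<sigma>_def)
    finally have "t * (\<zeta> \<bullet> v) \<le> \<epsilon> * (norm (?y - ?z0) - norm (z - ?z0))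
        + t * (G \<bullet> v) + t\<^sup>2 * (K / 2 * (P1 v \<bullet> P1 v + P2 v \<bullet> P2 v))"
      unfolding G by (simp add: \<alpha>_def \<beta>_def algebra_simps)
    moreover have "\<epsilon> * (norm (?y - ?z0) - norm (z - ?z0)) \<le> \<epsilon> * (t * norm v)"
      using ny \<epsilon> by (intro mult_left_mono) auto
    moreover have "v \<bullet> v = \<zeta> \<bullet> v - G \<bullet> v" by (simp add: v_def inner_diff_left)
    ultimately show "t * (v \<bullet> v) \<le> \<epsilon> * (t * norm v)
        + t\<^sup>2 * (K / 2 * (P1 v \<bullet> P1 v + P2 v \<bullet> P2 v))"
      by (simp add: right_diff_distrib)
  qed (use \<epsilon> in simp)
  moreover have "norm \<alpha> \<le> 4 * \<kappa> * (norm \<zeta> + \<epsilon>)"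
  proof -
    have "norm \<alpha> = K * \<rho>" using K by (simp add: \<alpha>_def \<rho>_def dist_norm)
    also have "\<dots> \<le> K * (\<rho> + \<sigma>)" using K \<rho>\<sigma> by simp
    finally show ?thesis using bd by (simp add: c_def)
  qed
  moreover have "norm \<beta> \<le> 4 * \<kappa> * (norm \<zeta> + \<epsilon>)"
  proof -
    have "norm \<beta> = K * \<sigma>" using K by (simp add: \<beta>_def \<sigma>_def dist_norm)
    also have "\<dots> \<le> K * (\<rho> + \<sigma>)" using K \<rho>\<sigma> by simp
    finally show ?thesis using bd by (simp add: c_def)
  qed
  moreover have "dist p (x0, w0) \<le> \<epsilon>"
  proof -
    have "dist (P1 z) (x0, w0) \<le> norm (z - ?z0)"
    proof -
      have "dist (P1 z) (x0, w0) \<le> dist z ?z0"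
        by (cases z) (simp add: P1_def dist_prod_def)
      then show ?thesis by (simp add: dist_norm)
    qed
    then show ?thesis
      using dist_triangle[of p "(x0, w0)" "P1 z"] s zz \<rho>\<sigma> by (simp add: \<rho>_def dist_commute)
  qed
  moreover have "dist q (w0, u0) \<le> \<epsilon>"
  proof -
    have "dist (P2 z) (w0, u0) \<le> norm (z - ?z0)"
      using dist_snd_le[of z ?z0] by (simp add: P2_def dist_norm)
    then show ?thesis
      using dist_triangle[of q "(w0, u0)" "P2 z"] s zz \<rho>\<sigma> by (simp add: \<sigma>_def dist_commute)
  qed
  moreover have "\<alpha> \<in> regular_normal_cone A p" "\<beta> \<in> regular_normal_cone B q"
    unfolding \<alpha>_def \<beta>_def using p q K by (auto intro!: projection_residual_regular_normal)
  ultimately show thesis using that[of p q \<alpha> \<beta>] by (simp add: v_def G_def)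
qed

section \<open>Directional neighbourhoods and subregularity\<close>

text \<open>
  The strict form of the inequalities that define a directional neighbourhood is an open
  condition, invariant under positive scaling and true at \<open>u\<close> itself if \<open>u \<noteq> 0\<close>; for \<open>u = 0\<close> it
  is dropped, and the neighbourhood is a ball.
  A whole ball is needed because the penalty argument leaves the sequence.
\<close>

lemma dir_nbhd_eventually_ball:
  assumes U: "dir_nbhd u U" and t: "\<And>k. t k > (0::real)" "t \<longlonglongrightarrow> 0" and u': "u' \<longlonglongrightarrow> u"
  shows "\<forall>\<^sub>F k in sequentially. \<exists>r>0. ball (t k *\<^sub>R u' k) r \<subseteq> U"
proof -
  obtain \<rho> \<delta> where \<rho>: "\<rho> > 0" and \<delta>: "\<delta> > 0" and sub: "dir_nbhd_base \<rho> \<delta> u \<subseteq> U"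
    using U unfolding dir_nbhd_def by blast
  define W where "W = {z. norm z < \<rho> \<and>
     (u = 0 \<or> norm (norm u *\<^sub>R z - norm z *\<^sub>R u) < \<delta> * norm z * norm u)}"
  have op: "open W"
  proof (cases "u = 0")
    case True
    then have "W = {z. norm z < \<rho>}" by (simp add: W_def)
    also have "open \<dots>" by (intro open_Collect_less continuous_intros)
    finally show ?thesis .
  next
    case False
    then have "W = {z. norm z < \<rho>} \<inter>
        {z. norm (norm u *\<^sub>R z - norm z *\<^sub>R u) < \<delta> * norm z * norm u}"
      by (auto simp: W_def)
    also have "open \<dots>" by (intro open_Int open_Collect_less continuous_intros)
    finally show ?thesis .
  qed
  have "W \<subseteq> dir_nbhd_base \<rho> \<delta> u" by (auto simp: W_def dir_nbhd_base_def)
  then have WU: "W \<subseteq> U" using sub by (rule order_trans)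
  have "(\<lambda>k. norm (t k *\<^sub>R u' k)) \<longlonglongrightarrow> norm (0 *\<^sub>R u)"
    by (intro tendsto_intros t u')
  then have 1: "\<forall>\<^sub>F k in sequentially. norm (t k *\<^sub>R u' k) < \<rho>"
    by (rule order_tendstoD(2)) (simp add: \<rho>)
  have 2: "\<forall>\<^sub>F k in sequentially. u = 0 \<or>
     norm (norm u *\<^sub>R u' k - norm (u' k) *\<^sub>R u) < \<delta> * norm (u' k) * norm u"
  proof (cases "u = 0")
    case False
    have "(\<lambda>k. \<delta> * norm (u' k) * norm u - norm (norm u *\<^sub>R u' k - norm (u' k) *\<^sub>R u))
       \<longlonglongrightarrow> \<delta> * norm u * norm u - norm (norm u *\<^sub>R u - norm u *\<^sub>R u)"
      by (intro tendsto_intros u')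
    moreover have "0 < \<delta> * norm u * norm u - norm (norm u *\<^sub>R u - norm u *\<^sub>R u)"
      using \<delta> False by simp
    ultimately have "\<forall>\<^sub>F k in sequentially.
        0 < \<delta> * norm (u' k) * norm u - norm (norm u *\<^sub>R u' k - norm (u' k) *\<^sub>R u)"
      by (rule order_tendstoD(1))
    then show ?thesis by (rule eventually_mono) simp
  qed simp
  from 1 2 show ?thesis
  proof eventually_elim
    case (elim k)
    have "norm (norm u *\<^sub>R (t k *\<^sub>R u' k) - norm (t k *\<^sub>R u' k) *\<^sub>R u)
        = t k * norm (norm u *\<^sub>R u' k - norm (u' k) *\<^sub>R u)"
    proof -
      have "norm u *\<^sub>R (t k *\<^sub>R u' k) - norm (t k *\<^sub>R u' k) *\<^sub>R u
          = t k *\<^sub>R (norm u *\<^sub>R u' k - norm (u' k) *\<^sub>R u)"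
        using t(1)[of k] by (simp add: scaleR_diff_right)
      then show ?thesis using t(1)[of k] by simp
    qed
    moreover have "t k * norm (norm u *\<^sub>R u' k - norm (u' k) *\<^sub>R u)
        < t k * (\<delta> * norm (u' k) * norm u)" if "u \<noteq> 0"
      using elim that t(1)[of k] by simp
    moreover have "t k * (\<delta> * norm (u' k) * norm u) = \<delta> * norm (t k *\<^sub>R u' k) * norm u"
      using t(1)[of k] by simp
    ultimately have "t k *\<^sub>R u' k \<in> W"
      using elim(1) unfolding W_def by (cases "u = 0") simp_all
    then obtain r where "r > 0" "ball (t k *\<^sub>R u' k) r \<subseteq> W"
      using op openE by blast
    then show ?case using WU by blast
  qed
qed

lemma zero_mem_translate_iff: "0 \<in> (\<lambda>p. p - p0) ` A \<longleftrightarrow> p0 \<in> A"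
  for p0 :: "'a::ab_group_add"
  by force

text \<open>
  Elements of \<open>F(z)\<close> are pairs of residuals \<open>p - (x, w)\<close>, \<open>q - (w, u)\<close>, so each choice of \<open>p\<close> and
  \<open>q\<close> bounds the distance from \<open>F(z)\<close> to the origin. All sets involved are nonempty, which
  removes the infinite distances.
\<close>

lemma chain_map_subregular_estimate:
  fixes S1 :: "'a::real_normed_vector \<Rightarrow> 'b::real_normed_vector set"
    and S2 :: "'b \<Rightarrow> 'c::real_normed_vector set"
  assumes ms: "metrically_subregular_dir (chain_map S1 S2) ((x, w, u), (0, 0)) d"
  obtains \<kappa> U where "\<kappa> > 0" "dir_nbhd d U"
    "\<And>z p q. z \<in> (+) (x, w, u) ` U \<Longrightarrow> p \<in> gph S1 \<Longrightarrow> q \<in> gph S2 \<Longrightarrow>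
       infdist z (chain_set (gph S1) (gph S2))
         \<le> \<kappa> * (dist (fst z, fst (snd z)) p + dist (snd z) q)"
proof -
  let ?F = "chain_map S1 S2" and ?C = "chain_set (gph S1) (gph S2)"
  have C: "minv ?F (0, 0) = ?C"
  proof (rule set_eqI)
    fix y :: "'a \<times> 'b \<times> 'c"
    obtain a b c where y: "y = (a, b, c)" by (cases y)
    show "y \<in> minv ?F (0, 0) \<longleftrightarrow> y \<in> ?C"
      by (simp add: y minv_def chain_map_def chain_set_def zero_mem_translate_iff)
  qed
  from ms obtain \<kappa> U where \<kappa>: "\<kappa> > 0" and U: "dir_nbhd d U"
    and le: "\<And>z. z \<in> (+) (x, w, u) ` U \<Longrightarrow>
        edist_set (minv ?F (0, 0)) z \<le> ereal \<kappa> * edist_set (?F z) (0, 0)"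
    and base: "((x, w, u), (0, 0)) \<in> gph ?F"
    unfolding metrically_subregular_dir_def fst_conv snd_conv by blast
  have ne: "?C \<noteq> {}"
  proof -
    have "(x, w, u) \<in> minv ?F (0, 0)" using base by (simp add: gph_def minv_def)
    then show ?thesis unfolding C by blast
  qed
  show thesis
  proof (rule that[OF \<kappa> U])
    fix z p q assume z: "z \<in> (+) (x, w, u) ` U" and p: "p \<in> gph S1" and q: "q \<in> gph S2"
    obtain a b c where abc: "z = (a, b, c)" by (cases z)
    let ?e = "(p - (a, b), q - (b, c))"
    have e: "?e \<in> ?F z" using p q by (auto simp: chain_map_def abc)
    then have "edist_set (?F z) (0, 0) = ereal (infdist (0, 0) (?F z))"
      by (auto simp: edist_set_def)
    then have "infdist z ?C \<le> \<kappa> * infdist (0, 0) (?F z)"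
      using le[OF z] ne by (simp add: C edist_set_def)
    also have "infdist (0, 0) (?F z) \<le> dist (0, 0) ?e" by (rule infdist_le[OF e])
    also have "dist (0, 0) ?e \<le> dist (a, b) p + dist (b, c) q"
    proof -
      have "dist (0, 0) ?e = norm ?e" by (metis dist_0_norm zero_prod_def)
      also have "\<dots> \<le> norm (p - (a, b)) + norm (q - (b, c))" by (rule norm_Pair_le)
      finally show ?thesis by (simp only: dist_norm norm_minus_commute)
    qed
    finally show "infdist z ?C \<le> \<kappa> * (dist (fst z, fst (snd z)) p + dist (snd z) q)"
      using \<kappa> by (simp add: abc)
  qed
qed

section \<open>The directional intersection rule\<close>

text \<open>
  Moving the base points by \<open>o(\<tau>\<^sub>k)\<close> changes the difference quotients by \<open>o(1)\<close>, so the direction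
  survives.
\<close>

lemma dir_normal_coneI_perturbed:
  assumes \<tau>: "\<And>k. \<tau> k > (0::real)" "\<tau> \<longlonglongrightarrow> 0" and d: "d \<longlonglongrightarrow> u"
    and \<epsilon>: "\<epsilon> \<longlonglongrightarrow> 0" and p: "\<And>k. dist (p k) (x + \<tau> k *\<^sub>R d k) \<le> \<epsilon> k * \<tau> k"
    and \<alpha>: "\<alpha> \<longlonglongrightarrow> \<xi>" "\<And>k. \<alpha> k \<in> regular_normal_cone \<Omega> (p k)"
  shows "\<xi> \<in> dir_normal_cone \<Omega> x u"
proof -
  define u' where "u' = (\<lambda>k. (p k - x) /\<^sub>R \<tau> k)"
  have pk: "x + \<tau> k *\<^sub>R u' k = p k" for k using \<tau>(1)[of k] by (simp add: u'_def)
  have "norm (u' k - d k) \<le> \<epsilon> k" for k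
  proof -
    have "u' k - d k = (p k - (x + \<tau> k *\<^sub>R d k)) /\<^sub>R \<tau> k"
      using \<tau>(1)[of k] by (simp add: u'_def algebra_simps)
    then have "norm (u' k - d k) = dist (p k) (x + \<tau> k *\<^sub>R d k) / \<tau> k"
      using \<tau>(1)[of k] by (simp add: dist_norm divide_inverse mult.commute)
    also have "\<dots> \<le> \<epsilon> k" using p[of k] \<tau>(1)[of k] by (simp add: pos_divide_le_eq)
    finally show ?thesis .
  qed
  then have "(\<lambda>k. u' k - d k) \<longlonglongrightarrow> 0"
    by (intro Lim_null_comparison[OF _ \<epsilon>]) simp
  from tendsto_add[OF this d] have "u' \<longlonglongrightarrow> u" by simp
  then show ?thesis unfolding dir_normal_cone_def
    using \<tau> \<alpha> pk by (intro CollectI exI[of _ \<tau>] exI[of _ u'] exI[of _ \<alpha>]) simp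
qed

text \<open>
  Approximate multipliers are taken at the \<open>k\<close>-th point with tolerance \<open>\<epsilon>\<^sub>k \<tau>\<^sub>k\<close>, where
  \<open>\<epsilon>\<^sub>k \<longlonglongrightarrow> 0\<close>: then the points at which they are normal keep the direction. Their bound is a
  fixed multiple of \<open>\<bar>\<zeta>\<^sub>k\<bar> + \<epsilon>\<^sub>k \<tau>\<^sub>k\<close>, a convergent sequence, so a subsequence converges.
\<close>

lemma directional_chain_normals:
  fixes S1 :: "'a::euclidean_space \<Rightarrow> 'b::euclidean_space set" and S2 :: "'b \<Rightarrow> 'c::euclidean_space set"
  assumes clA: "closed (gph S1)" and clB: "closed (gph S2)"
    and ms: "metrically_subregular_dir (chain_map S1 S2) ((x, w, u), (0, 0)) (a, b, c)"
    and \<tau>: "\<And>k. \<tau> k > 0" "\<tau> \<longlonglongrightarrow> 0"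
    and a: "a' \<longlonglongrightarrow> a" and b: "b' \<longlonglongrightarrow> b" and c: "c' \<longlonglongrightarrow> c"
    and \<zeta>: "\<And>k. \<zeta> k \<in> regular_normal_cone (chain_set (gph S1) (gph S2))
               (x + \<tau> k *\<^sub>R a' k, w + \<tau> k *\<^sub>R b' k, u + \<tau> k *\<^sub>R c' k)"
    and lim: "\<zeta> \<longlonglongrightarrow> (\<xi>, \<omega>, \<eta>)"
  obtains v1 v2 where "v1 + v2 = \<omega>"
    "(\<xi>, v1) \<in> dir_normal_cone (gph S1) (x, w) (a, b)"
    "(v2, \<eta>) \<in> dir_normal_cone (gph S2) (w, u) (b, c)"
proof -
  let ?A = "gph S1" and ?B = "gph S2"
  let ?z = "\<lambda>k. (x + \<tau> k *\<^sub>R a' k, w + \<tau> k *\<^sub>R b' k, u + \<tau> k *\<^sub>R c' k)"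
  obtain \<kappa> U where \<kappa>: "\<kappa> > 0" and U: "dir_nbhd (a, b, c) U"
    and est: "\<And>z p q. z \<in> (+) (x, w, u) ` U \<Longrightarrow> p \<in> ?A \<Longrightarrow> q \<in> ?B \<Longrightarrow>
       infdist z (chain_set ?A ?B) \<le> \<kappa> * (dist (fst z, fst (snd z)) p + dist (snd z) q)"
    using chain_map_subregular_estimate[OF ms] by metis
  have "(\<lambda>k. (a' k, b' k, c' k)) \<longlonglongrightarrow> (a, b, c)" by (intro tendsto_intros a b c)
  from dir_nbhd_eventually_ball[OF U \<tau> this]
  obtain N where N: "\<And>k. k \<ge> N \<Longrightarrow> \<exists>r>0. ball (\<tau> k *\<^sub>R (a' k, b' k, c' k)) r \<subseteq> U"
    unfolding eventually_sequentially by blast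
  define \<epsilon> where "\<epsilon> = (\<lambda>k. inverse (real (Suc k)))"
  have \<epsilon>: "\<epsilon> k > 0" "\<epsilon> \<longlonglongrightarrow> 0" for k
    unfolding \<epsilon>_def using LIMSEQ_inverse_real_of_nat by auto
  have mult: "\<exists>p q \<alpha> \<beta>. dist p (x + \<tau> k *\<^sub>R a' k, w + \<tau> k *\<^sub>R b' k) \<le> \<epsilon> k * \<tau> k \<and>
      dist q (w + \<tau> k *\<^sub>R b' k, u + \<tau> k *\<^sub>R c' k) \<le> \<epsilon> k * \<tau> k \<and>
      \<alpha> \<in> regular_normal_cone ?A p \<and> \<beta> \<in> regular_normal_cone ?B q \<and>
      norm \<alpha> \<le> 4 * \<kappa> * (norm (\<zeta> k) + \<epsilon> k * \<tau> k) \<and> norm \<beta> \<le> 4 * \<kappa> * (norm (\<zeta> k) + \<epsilon> k * \<tau> k) \<and>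
      norm (\<zeta> k - (fst \<alpha>, snd \<alpha> + fst \<beta>, snd \<beta>)) \<le> \<epsilon> k * \<tau> k" if "k \<ge> N" for k
  proof -
    obtain r where r: "r > 0" "ball (\<tau> k *\<^sub>R (a' k, b' k, c' k)) r \<subseteq> U" using N \<open>k \<ge> N\<close> by blast
    have loc: "infdist (x', w', u') (chain_set ?A ?B) \<le> \<kappa> * (dist (x', w') p + dist (w', u') q)"
      if "dist (x', w', u') (?z k) < r" "p \<in> ?A" "q \<in> ?B" for x' w' u' p q
    proof -
      let ?d = "(x', w', u') - (x, w, u)"
      have "dist (\<tau> k *\<^sub>R (a' k, b' k, c' k)) ?d = dist (?z k) (x', w', u')"
        unfolding dist_norm by (simp add: algebra_simps)
      then have "?d \<in> U" using that(1) r(2) by (auto simp: dist_commute)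
      then have "(x', w', u') \<in> (+) (x, w, u) ` U" by (intro image_eqI[of _ _ ?d]) auto
      from est[OF this that(2,3)] show ?thesis by simp
    qed
    have "\<epsilon> k * \<tau> k > 0" using \<epsilon> \<tau> by simp
    then show ?thesis
      by (rule fuzzy_chain_multipliers[OF clA clB \<zeta>[of k] \<kappa> r(1), rotated]) (blast, erule (2) loc)
  qed
  \<comment> \<open>Only indices from \<open>N\<close> on lie in the directional neighbourhood.\<close>
  define e where "e = (\<lambda>k. \<epsilon> (k + N) * \<tau> (k + N))"
  define z where "z = (\<lambda>k. \<zeta> (k + N))"
  have "\<forall>k. \<exists>p q \<alpha> \<beta>. dist p (x + \<tau> (k + N) *\<^sub>R a' (k + N), w + \<tau> (k + N) *\<^sub>R b' (k + N)) \<le> e k \<and>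
      dist q (w + \<tau> (k + N) *\<^sub>R b' (k + N), u + \<tau> (k + N) *\<^sub>R c' (k + N)) \<le> e k \<and>
      \<alpha> \<in> regular_normal_cone ?A p \<and> \<beta> \<in> regular_normal_cone ?B q \<and>
      norm \<alpha> \<le> 4 * \<kappa> * (norm (z k) + e k) \<and> norm \<beta> \<le> 4 * \<kappa> * (norm (z k) + e k) \<and>
      norm (z k - (fst \<alpha>, snd \<alpha> + fst \<beta>, snd \<beta>)) \<le> e k"
    using mult unfolding e_def z_def by simp
  then obtain p q \<alpha> \<beta> where
    p: "\<And>k. dist (p k) (x + \<tau> (k + N) *\<^sub>R a' (k + N), w + \<tau> (k + N) *\<^sub>R b' (k + N)) \<le> e k"
    and q: "\<And>k. dist (q k) (w + \<tau> (k + N) *\<^sub>R b' (k + N), u + \<tau> (k + N) *\<^sub>R c' (k + N)) \<le> e k"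
    and \<alpha>: "\<And>k. \<alpha> k \<in> regular_normal_cone ?A (p k)" and \<beta>: "\<And>k. \<beta> k \<in> regular_normal_cone ?B (q k)"
    and n\<alpha>: "\<And>k. norm (\<alpha> k) \<le> 4 * \<kappa> * (norm (z k) + e k)"
    and n\<beta>: "\<And>k. norm (\<beta> k) \<le> 4 * \<kappa> * (norm (z k) + e k)"
    and err: "\<And>k. norm (z k - (fst (\<alpha> k), snd (\<alpha> k) + fst (\<beta> k), snd (\<beta> k))) \<le> e k"
    by metis
  have shift: "(\<lambda>k. s (k + N)) \<longlonglongrightarrow> l" if "s \<longlonglongrightarrow> l" for s :: "nat \<Rightarrow> 'd::topological_space" and l
    using LIMSEQ_ignore_initial_segment[OF that, of N] by simp
  have e0: "e \<longlonglongrightarrow> 0"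
    using tendsto_mult[OF shift[OF \<epsilon>(2)] shift[OF \<tau>(2)]] by (simp add: e_def)
  have zl: "z \<longlonglongrightarrow> (\<xi>, \<omega>, \<eta>)" unfolding z_def by (rule shift[OF lim])
  have "(\<lambda>k. 4 * \<kappa> * (norm (z k) + e k)) \<longlonglongrightarrow> 4 * \<kappa> * (norm (\<xi>, \<omega>, \<eta>) + 0)"
    by (intro tendsto_intros zl e0)
  then have "Bseq (\<lambda>k. 4 * \<kappa> * (norm (z k) + e k))" by (intro convergent_imp_Bseq convergentI)
  then obtain M where M: "\<And>k. 4 * \<kappa> * (norm (z k) + e k) \<le> M"
    unfolding Bseq_def by (metis abs_le_D1 real_norm_def)
  have "bounded (range (\<lambda>k. (\<alpha> k, \<beta> k)))"
  proof (rule boundedI)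
    fix y assume "y \<in> range (\<lambda>k. (\<alpha> k, \<beta> k))"
    then obtain k where "y = (\<alpha> k, \<beta> k)" by blast
    then show "norm y \<le> M + M"
      using norm_Pair_le[of "\<alpha> k" "\<beta> k"] n\<alpha>[of k] n\<beta>[of k] M[of k] by simp
  qed
  then obtain lm g where g: "strict_mono g" "((\<lambda>k. (\<alpha> k, \<beta> k)) \<circ> g) \<longlonglongrightarrow> lm"
    using bounded_imp_convergent_subsequence by blast
  obtain \<alpha>0 \<beta>0 where lm: "lm = (\<alpha>0, \<beta>0)" by (cases lm)
  have \<alpha>l: "(\<lambda>k. \<alpha> (g k)) \<longlonglongrightarrow> \<alpha>0" using tendsto_fst[OF g(2)] by (simp add: lm o_def)
  have \<beta>l: "(\<lambda>k. \<beta> (g k)) \<longlonglongrightarrow> \<beta>0" using tendsto_snd[OF g(2)] by (simp add: lm o_def)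
  have sub: "(\<lambda>k. s (g k)) \<longlonglongrightarrow> l" if "s \<longlonglongrightarrow> l" for s :: "nat \<Rightarrow> 'd::topological_space" and l
    using LIMSEQ_subseq_LIMSEQ[OF that g(1)] by (simp add: o_def)
  have shsub: "(\<lambda>k. s (g k + N)) \<longlonglongrightarrow> l" if "s \<longlonglongrightarrow> l" for s :: "nat \<Rightarrow> 'd::topological_space" and l
    using sub[OF shift[OF that]] by simp
  have "(\<lambda>k. z (g k) - (fst (\<alpha> (g k)), snd (\<alpha> (g k)) + fst (\<beta> (g k)), snd (\<beta> (g k)))) \<longlonglongrightarrow> 0"
    by (rule Lim_null_comparison[OF _ sub[OF e0]]) (simp add: err)
  moreover have "(\<lambda>k. z (g k) - (fst (\<alpha> (g k)), snd (\<alpha> (g k)) + fst (\<beta> (g k)), snd (\<beta> (g k))))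
     \<longlonglongrightarrow> (\<xi>, \<omega>, \<eta>) - (fst \<alpha>0, snd \<alpha>0 + fst \<beta>0, snd \<beta>0)"
    by (intro tendsto_intros \<alpha>l \<beta>l sub[OF zl])
  ultimately have "(\<xi>, \<omega>, \<eta>) - (fst \<alpha>0, snd \<alpha>0 + fst \<beta>0, snd \<beta>0) = 0"
    using LIMSEQ_unique by blast
  then have eq: "\<alpha>0 = (\<xi>, snd \<alpha>0)" "\<beta>0 = (fst \<beta>0, \<eta>)" "snd \<alpha>0 + fst \<beta>0 = \<omega>"
    by (auto simp: prod_eq_iff)
  have 1: "\<alpha>0 \<in> dir_normal_cone ?A (x, w) (a, b)"
  proof (rule dir_normal_coneI_perturbed)
    show "(\<lambda>k. (a' (g k + N), b' (g k + N))) \<longlonglongrightarrow> (a, b)"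
      by (intro tendsto_intros shsub a b)
    show "(\<lambda>k. \<tau> (g k + N)) \<longlonglongrightarrow> 0" "(\<lambda>k. \<epsilon> (g k + N)) \<longlonglongrightarrow> 0"
      by (intro shsub \<tau> \<epsilon>)+
    show "dist (p (g k)) ((x, w) + \<tau> (g k + N) *\<^sub>R (a' (g k + N), b' (g k + N)))
        \<le> \<epsilon> (g k + N) * \<tau> (g k + N)" for k
      using p[of "g k"] by (simp add: e_def)
  qed (use \<tau> \<alpha> \<alpha>l in auto)
  have 2: "\<beta>0 \<in> dir_normal_cone ?B (w, u) (b, c)"
  proof (rule dir_normal_coneI_perturbed)
    show "(\<lambda>k. (b' (g k + N), c' (g k + N))) \<longlonglongrightarrow> (b, c)"
      by (intro tendsto_intros shsub b c)
    show "(\<lambda>k. \<tau> (g k + N)) \<longlonglongrightarrow> 0" "(\<lambda>k. \<epsilon> (g k + N)) \<longlonglongrightarrow> 0"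
      by (intro shsub \<tau> \<epsilon>)+
    show "dist (q (g k)) ((w, u) + \<tau> (g k + N) *\<^sub>R (b' (g k + N), c' (g k + N)))
        \<le> \<epsilon> (g k + N) * \<tau> (g k + N)" for k
      using q[of "g k"] by (simp add: e_def)
  qed (use \<tau> \<beta> \<beta>l in auto)
  show thesis
  proof (rule that[OF eq(3)])
    show "(\<xi>, snd \<alpha>0) \<in> dir_normal_cone ?A (x, w) (a, b)"
      using 1 by (subst eq(1)[symmetric])
    show "(fst \<beta>0, \<eta>) \<in> dir_normal_cone ?B (w, u) (b, c)"
      using 2 by (subst eq(2)[symmetric])
  qed
qed

section \<open>The chain rule\<close>

text \<open>
  Points of the chained set near \<open>(x, w, u)\<close> project to points of the composed graph that are
  at least as near to \<open>(x, u)\<close>, and the lifted functional ignores the middle component.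
\<close>

lemma regular_normal_mcomp_imp_chain_set:
  assumes n: "(\<xi>, \<eta>) \<in> regular_normal_cone (gph (S2 \<circ>\<^sub>m S1)) (x, u)"
    and w: "w \<in> \<Xi> S1 S2 (x, u)"
  shows "(\<xi>, 0, \<eta>) \<in> regular_normal_cone (chain_set (gph S1) (gph S2)) (x, w, u)"
  unfolding regular_normal_cone_iff
proof (intro conjI allI impI)
  show "(x, w, u) \<in> chain_set (gph S1) (gph S2)"
    using w by (simp add: intermediate_def mem_chain_set gph_def)
next
  fix \<epsilon> :: real assume \<epsilon>: "\<epsilon> > 0"
  with n obtain r where r: "r > 0"
    "\<And>z. z \<in> gph (S2 \<circ>\<^sub>m S1) \<Longrightarrow> dist z (x, u) < r \<Longrightarrow>
       (\<xi>, \<eta>) \<bullet> (z - (x, u)) \<le> \<epsilon> * norm (z - (x, u))"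
    unfolding regular_normal_cone_iff by blast
  have "(\<xi>, 0, \<eta>) \<bullet> (z - (x, w, u)) \<le> \<epsilon> * norm (z - (x, w, u))"
    if z: "z \<in> chain_set (gph S1) (gph S2)" "dist z (x, w, u) < r" for z
  proof -
    obtain x' w' u' where z': "z = (x', w', u')" by (cases z)
    have le: "dist (x', u') (x, u) \<le> dist z (x, w, u)"
      unfolding z' dist_prod_def by simp
    have "(x', u') \<in> gph (S2 \<circ>\<^sub>m S1)"
      using z(1) by (auto simp: z' mem_chain_set gph_def mcomp_def)
    then have "(\<xi>, \<eta>) \<bullet> ((x', u') - (x, u)) \<le> \<epsilon> * norm ((x', u') - (x, u))"
      using le z(2) by (intro r(2)) linarith+
    also have "\<dots> \<le> \<epsilon> * norm (z - (x, w, u))"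
      using le \<epsilon> by (intro mult_left_mono) (simp_all add: dist_norm)
    finally show ?thesis by (simp add: z')
  qed
  then show "\<exists>r>0. \<forall>z\<in>chain_set (gph S1) (gph S2). dist z (x, w, u) < r \<longrightarrow>
      (\<xi>, 0, \<eta>) \<bullet> (z - (x, w, u)) \<le> \<epsilon> * norm (z - (x, w, u))"
    using r(1) by blast
qed

lemma tangent_coneI_closed:
  assumes cl: "closed \<Omega>" and t: "\<And>k. t k > 0" "t \<longlonglongrightarrow> 0" and u: "u' \<longlonglongrightarrow> u"
    and mem: "\<And>k. x + t k *\<^sub>R u' k \<in> \<Omega>"
  shows "u \<in> tangent_cone \<Omega> x"
proof -
  have "(\<lambda>k. x + t k *\<^sub>R u' k) \<longlonglongrightarrow> x + 0 *\<^sub>R u" by (intro tendsto_intros t u)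
  then have "x \<in> \<Omega>" using closed_sequentially[OF cl mem] by simp
  then show ?thesis unfolding tangent_cone_def using t u mem by blast
qed

lemma eventually_bounded_imp_convergent_subsequence:
  fixes w :: "nat \<Rightarrow> 'a::heine_borel"
  assumes "\<forall>\<^sub>F k in sequentially. w k \<in> D" "bounded D"
  obtains i l where "strict_mono (i :: nat \<Rightarrow> nat)" "(\<lambda>k. w (i k)) \<longlonglongrightarrow> l"
proof -
  obtain N where "\<And>k. k \<ge> N \<Longrightarrow> w k \<in> D"
    using assms(1) unfolding eventually_sequentially by blast
  then have "range (\<lambda>k. w (k + N)) \<subseteq> D" by auto
  then have "bounded (range (\<lambda>k. w (k + N)))" by (rule bounded_subset[OF assms(2)])
  then obtain l g where g: "strict_mono g" "((\<lambda>k. w (k + N)) \<circ> g) \<longlonglongrightarrow> l"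
    using bounded_imp_convergent_subsequence by blast
  show thesis
    using g by (intro that[of "\<lambda>k. g k + N" l]) (auto simp: strict_mono_def o_def)
qed

text \<open>
  The middle component of the lifted normal is zero, so the middle components of the two graph
  normals are opposite to each other: they are \<open>-w*\<close> and \<open>w*\<close> for the intermediate dual vector
  \<open>w*\<close> of the composed coderivatives. Subregularity is assumed only for tangent directions,
  and the direction \<open>(a, b, c)\<close> is tangent because the triples lie in the chained set.
\<close>

lemma directional_chain_coderivative:
  fixes S1 :: "'a::euclidean_space \<Rightarrow> 'b::euclidean_space set" and S2 :: "'b \<Rightarrow> 'c::euclidean_space set"
  assumes clA: "closed (gph S1)" and clB: "closed (gph S2)"
    and ms: "(a, b) \<in> tangent_cone (gph S1) (x, w) \<Longrightarrow> (b, c) \<in> tangent_cone (gph S2) (w, u) \<Longrightarrow>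
      metrically_subregular_dir (chain_map S1 S2) ((x, w, u), (0, 0)) (a, b, c)"
    and \<tau>: "\<And>k. \<tau> k > 0" "\<tau> \<longlonglongrightarrow> 0"
    and a: "a' \<longlonglongrightarrow> a" and b: "b' \<longlonglongrightarrow> b" and c: "c' \<longlonglongrightarrow> c"
    and \<zeta>: "\<And>k. \<zeta> k \<in> regular_normal_cone (chain_set (gph S1) (gph S2))
               (x + \<tau> k *\<^sub>R a' k, w + \<tau> k *\<^sub>R b' k, u + \<tau> k *\<^sub>R c' k)"
    and lim: "\<zeta> \<longlonglongrightarrow> (\<xi>, 0, - us)"
  shows "b \<in> graph_deriv S1 (x, w) a" "c \<in> graph_deriv S2 (w, u) b"
    "\<xi> \<in> (dir_coderiv S1 (x, w) (a, b) \<circ>\<^sub>m dir_coderiv S2 (w, u) (b, c)) us"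
proof -
  have mem: "(x + \<tau> k *\<^sub>R a' k, w + \<tau> k *\<^sub>R b' k) \<in> gph S1"
    "(w + \<tau> k *\<^sub>R b' k, u + \<tau> k *\<^sub>R c' k) \<in> gph S2" for k
    using \<zeta>[of k] by (auto simp: regular_normal_cone_iff mem_chain_set)
  have T1: "(a, b) \<in> tangent_cone (gph S1) (x, w)"
    using mem by (intro tangent_coneI_closed[OF clA \<tau> tendsto_Pair[OF a b]]) simp
  have T2: "(b, c) \<in> tangent_cone (gph S2) (w, u)"
    using mem by (intro tangent_coneI_closed[OF clB \<tau> tendsto_Pair[OF b c]]) simp
  show "b \<in> graph_deriv S1 (x, w) a" "c \<in> graph_deriv S2 (w, u) b"
    using T1 T2 by (simp_all add: graph_deriv_def)
  obtain v1 v2 where v: "v1 + v2 = 0"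
    "(\<xi>, v1) \<in> dir_normal_cone (gph S1) (x, w) (a, b)"
    "(v2, - us) \<in> dir_normal_cone (gph S2) (w, u) (b, c)"
    using directional_chain_normals[OF clA clB ms[OF T1 T2] \<tau> a b c \<zeta> lim] by blast
  have "v1 = - v2" using v(1) by (simp add: eq_neg_iff_add_eq_0)
  then show "\<xi> \<in> (dir_coderiv S1 (x, w) (a, b) \<circ>\<^sub>m dir_coderiv S2 (w, u) (b, c)) us"
    using v(2,3) by (auto simp: mcomp_def dir_coderiv_def)
qed

theorem theorem5p1:
  fixes S1 :: "real ^ 'n \<Rightarrow> (real ^ 'm) set"
    and S2 :: "real ^ 'm \<Rightarrow> (real ^ 's) set"
    and S :: "real ^ 'n \<Rightarrow> (real ^ 's) set"
    and xb h :: "real ^ 'n" and ub l :: "real ^ 's"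
  assumes "outer_semicontinuous S1" and "outer_semicontinuous S2"
    and "S = S2 \<circ>\<^sub>m S1"
    and "xb \<in> mdom S" and "ub \<in> S xb"
    and a: "\<exists>U. dir_nbhd (h, l) U \<and> bounded (\<Union>p \<in> (+) (xb, ub) ` U. \<Xi> S1 S2 p)"
    and b1: "\<And>w k. w \<in> \<Xi> S1 S2 (xb, ub) \<Longrightarrow>
               (h, k) \<in> tangent_cone (gph S1) (xb, w) \<Longrightarrow>
               (k, l) \<in> tangent_cone (gph S2) (w, ub) \<Longrightarrow>
               metrically_subregular_dir (chain_map S1 S2) ((xb, w, ub), (0, 0)) (h, k, l)"
    and b2: "\<And>w k. w \<in> \<Xi> S1 S2 (xb, ub) \<Longrightarrow> k \<in> sphere 0 1 \<Longrightarrow>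
               (0, k) \<in> tangent_cone (gph S1) (xb, w) \<Longrightarrow>
               (k, 0) \<in> tangent_cone (gph S2) (w, ub) \<Longrightarrow>
               metrically_subregular_dir (chain_map S1 S2) ((xb, w, ub), (0, 0)) (0, k, 0)"
  shows "\<forall>us :: real ^ 's.
    dir_coderiv S (xb, ub) (h, l) us \<subseteq>
      (\<Union>w \<in> \<Xi> S1 S2 (xb, ub).
         (\<Union>k \<in> {k. k \<in> graph_deriv S1 (xb, w) h \<and> l \<in> graph_deriv S2 (w, ub) k}.
            (dir_coderiv S1 (xb, w) (h, k) \<circ>\<^sub>m dir_coderiv S2 (w, ub) (k, l)) us)
         \<union>
         (\<Union>k \<in> {k. k \<in> sphere 0 1 \<and> k \<in> graph_deriv S1 (xb, w) 0 \<and> 0 \<in> graph_deriv S2 (w, ub) k}.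
            (dir_coderiv S1 (xb, w) (0, k) \<circ>\<^sub>m dir_coderiv S2 (w, ub) (k, 0)) us))"
proof (intro allI subsetI)
  fix us \<xi>
  assume "\<xi> \<in> dir_coderiv S (xb, ub) (h, l) us"
  then obtain t p n where t: "\<And>k. t k > (0::real)" "t \<longlonglongrightarrow> 0"
    and p: "p \<longlonglongrightarrow> (h, l)" and n: "n \<longlonglongrightarrow> (\<xi>, - us)"
    and N: "\<And>k. n k \<in> regular_normal_cone (gph S) ((xb, ub) + t k *\<^sub>R p k)"
    unfolding dir_coderiv_def dir_normal_cone_def by blast
  have cl: "closed (gph S1)" "closed (gph S2)"
    using assms(1,2) by (auto simp: outer_semicontinuous_def)
  define x where "x = (\<lambda>k. xb + t k *\<^sub>R fst (p k))"
  define u where "u = (\<lambda>k. ub + t k *\<^sub>R snd (p k))"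
  have pt: "(xb, ub) + t k *\<^sub>R p k = (x k, u k)" for k
    by (simp add: x_def u_def prod_eq_iff)
  have "\<exists>w. w \<in> \<Xi> S1 S2 (x k, u k)" for k
    using N[of k] unfolding pt regular_normal_cone_iff
    by (auto simp: assms(3) gph_def mcomp_def intermediate_def)
  then obtain w where w: "\<And>k. w k \<in> \<Xi> S1 S2 (x k, u k)" by metis
  have \<zeta>: "(fst (n k), 0, snd (n k)) \<in> regular_normal_cone (chain_set (gph S1) (gph S2)) (x k, w k, u k)"
    for k
    using N[of k] w[of k] unfolding pt assms(3)
    by (intro regular_normal_mcomp_imp_chain_set) simp_all
  obtain U where U: "dir_nbhd (h, l) U" and bd: "bounded (\<Union>p \<in> (+) (xb, ub) ` U. \<Xi> S1 S2 p)"
    using a by blast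
  have "\<forall>\<^sub>F k in sequentially. w k \<in> (\<Union>p \<in> (+) (xb, ub) ` U. \<Xi> S1 S2 p)"
    using dir_nbhd_eventually_ball[OF U t p]
  proof eventually_elim
    case (elim k)
    then have "t k *\<^sub>R p k \<in> U" by (meson centre_in_ball subsetD)
    then show ?case using w[of k] unfolding pt[symmetric] by blast
  qed
  then obtain i wb where i: "strict_mono (i :: nat \<Rightarrow> nat)" "(\<lambda>k. w (i k)) \<longlonglongrightarrow> wb"
    using bd by (rule eventually_bounded_imp_convergent_subsequence)
  \<comment> \<open>This scale dominates both \<open>t\<close> and the displacement of \<open>w\<close>, so a single compactness argument
    serves both speeds at which \<open>w\<close> may approach its limit.\<close>
  define \<tau> where "\<tau> = (\<lambda>k. max (t (i k)) (norm (w (i k) - wb)))"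
  have \<tau>: "\<tau> k > 0" "t (i k) \<le> \<tau> k" "norm (w (i k) - wb) \<le> \<tau> k" for k
    using t(1)[of "i k"] by (auto simp: \<tau>_def)
  define y where "y = (\<lambda>k. (t (i k) / \<tau> k, (w (i k) - wb) /\<^sub>R \<tau> k))"
  have "bounded (range y)"
  proof (rule boundedI)
    fix z assume "z \<in> range y"
    then obtain k where z: "z = y k" by blast
    have "norm (t (i k) / \<tau> k) \<le> 1"
      using \<tau>[of k] t(1)[of "i k"] by simp
    moreover have "norm ((w (i k) - wb) /\<^sub>R \<tau> k) \<le> 1"
    proof -
      have "norm ((w (i k) - wb) /\<^sub>R \<tau> k) = norm (w (i k) - wb) / \<tau> k"
        using \<tau>(1)[of k] by (simp add: divide_inverse_commute)
      then show ?thesis using \<tau>[of k] by simp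
    qed
    ultimately show "norm z \<le> 2"
      using norm_Pair_le[of "t (i k) / \<tau> k" "(w (i k) - wb) /\<^sub>R \<tau> k"] by (simp add: z y_def)
  qed
  then obtain ll g where g: "strict_mono (g :: nat \<Rightarrow> nat)" "(y \<circ> g) \<longlonglongrightarrow> ll"
    using bounded_imp_convergent_subsequence by blast
  obtain L e where ll: "ll = (L, e)" by (cases ll)
  define j where "j = (\<lambda>k. i (g k))"
  have jm: "strict_mono j" using i(1) g(1) by (simp add: j_def strict_mono_def)
  have sub: "(\<lambda>k. s (j k)) \<longlonglongrightarrow> m" if "s \<longlonglongrightarrow> m" for s :: "nat \<Rightarrow> 'd::topological_space" and m
    using LIMSEQ_subseq_LIMSEQ[OF that jm] by (simp add: o_def)
  have wj: "(\<lambda>k. w (j k)) \<longlonglongrightarrow> wb"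
    using LIMSEQ_subseq_LIMSEQ[OF i(2) g(1)] by (simp add: o_def j_def)
  have tj: "(\<lambda>k. t (j k)) \<longlonglongrightarrow> 0" by (rule sub[OF t(2)])
  define \<sigma> where "\<sigma> = (\<lambda>k. \<tau> (g k))"
  have \<sigma>_eq: "\<sigma> k = max (t (j k)) (norm (w (j k) - wb))" for k by (simp add: \<sigma>_def \<tau>_def j_def)
  have \<sigma>0: "\<sigma> k > 0" for k by (simp add: \<sigma>_def \<tau>)
  have "\<sigma> \<longlonglongrightarrow> max 0 (norm (wb - wb))"
    unfolding \<sigma>_eq[abs_def] by (intro tendsto_intros tj wj)
  then have \<sigma>l: "\<sigma> \<longlonglongrightarrow> 0" by simp
  have Ll: "(\<lambda>k. t (j k) / \<sigma> k) \<longlonglongrightarrow> L"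
    using tendsto_fst[OF g(2)] by (simp add: ll y_def o_def j_def \<sigma>_def)
  have el: "(\<lambda>k. (w (j k) - wb) /\<^sub>R \<sigma> k) \<longlonglongrightarrow> e"
    using tendsto_snd[OF g(2)] by (simp add: ll y_def o_def j_def \<sigma>_def)
  have hl: "(\<lambda>k. fst (p (j k))) \<longlonglongrightarrow> h" and lll: "(\<lambda>k. snd (p (j k))) \<longlonglongrightarrow> l"
    using tendsto_fst[OF sub[OF p]] tendsto_snd[OF sub[OF p]] by simp_all
  have \<zeta>l: "(\<lambda>k. (fst (n (j k)), 0 :: real ^ 'm, snd (n (j k)))) \<longlonglongrightarrow> (\<xi>, 0, - us)"
  proof -
    have "(\<lambda>k. fst (n (j k))) \<longlonglongrightarrow> \<xi>" "(\<lambda>k. snd (n (j k))) \<longlonglongrightarrow> - us"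
      using tendsto_fst[OF sub[OF n]] tendsto_snd[OF sub[OF n]] by simp_all
    then show ?thesis by (rule tendsto_Pair[OF _ tendsto_Pair[OF tendsto_const]])
  qed
  have wb: "wb \<in> \<Xi> S1 S2 (xb, ub)"
  proof -
    have "(\<lambda>k. x (j k)) \<longlonglongrightarrow> xb + 0 *\<^sub>R h" "(\<lambda>k. u (j k)) \<longlonglongrightarrow> ub + 0 *\<^sub>R l"
      unfolding x_def u_def by (intro tendsto_add tendsto_scaleR tendsto_const tj hl lll)+
    from tendsto_Pair[OF this(1) tendsto_Pair[OF wj this(2)]]
    have "(\<lambda>k. (x (j k), w (j k), u (j k))) \<longlonglongrightarrow> (xb, wb, ub)" by simp
    from closed_sequentially[OF closed_chain_set[OF cl] _ this]
    have "(xb, wb, ub) \<in> chain_set (gph S1) (gph S2)"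
      using \<zeta> by (simp add: regular_normal_cone_iff)
    then show ?thesis by (simp add: mem_chain_set gph_def intermediate_def)
  qed
  have "(\<lambda>k. max (t (j k) / \<sigma> k) (norm ((w (j k) - wb) /\<^sub>R \<sigma> k))) \<longlonglongrightarrow> max L (norm e)"
    by (intro tendsto_intros Ll el)
  moreover have "max (t (j k) / \<sigma> k) (norm ((w (j k) - wb) /\<^sub>R \<sigma> k)) = 1" for k
  proof -
    have "max (t (j k) / \<sigma> k) (norm ((w (j k) - wb) /\<^sub>R \<sigma> k))
        = max (t (j k)) (norm (w (j k) - wb)) / \<sigma> k"
      using \<sigma>0[of k] by (auto simp: max_def divide_simps)
    then show ?thesis using \<sigma>0[of k] by (simp add: \<sigma>_eq[symmetric])
  qed
  ultimately have max1: "max L (norm e) = 1" by (simp add: LIMSEQ_const_iff)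
  show "\<xi> \<in> (\<Union>w \<in> \<Xi> S1 S2 (xb, ub).
         (\<Union>k \<in> {k. k \<in> graph_deriv S1 (xb, w) h \<and> l \<in> graph_deriv S2 (w, ub) k}.
            (dir_coderiv S1 (xb, w) (h, k) \<circ>\<^sub>m dir_coderiv S2 (w, ub) (k, l)) us)
         \<union>
         (\<Union>k \<in> {k. k \<in> sphere 0 1 \<and> k \<in> graph_deriv S1 (xb, w) 0 \<and> 0 \<in> graph_deriv S2 (w, ub) k}.
            (dir_coderiv S1 (xb, w) (0, k) \<circ>\<^sub>m dir_coderiv S2 (w, ub) (k, 0)) us))"
  proof (cases "L = 0")
    \<comment> \<open>The displacement of \<open>w\<close> is of order \<open>t\<close>: the original scale works, with \<open>k = e / L\<close>.\<close>
    case False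
    define b' where "b' = (\<lambda>k. (w (j k) - wb) /\<^sub>R t (j k))"
    have "(\<lambda>k. ((w (j k) - wb) /\<^sub>R \<sigma> k) /\<^sub>R (t (j k) / \<sigma> k)) \<longlonglongrightarrow> e /\<^sub>R L"
      by (intro tendsto_intros Ll el False)
    moreover have "((w (j k) - wb) /\<^sub>R \<sigma> k) /\<^sub>R (t (j k) / \<sigma> k) = b' k" for k
      using \<sigma>0[of k] by (simp add: b'_def field_simps)
    ultimately have b': "b' \<longlonglongrightarrow> e /\<^sub>R L" by simp
    have wk: "wb + t (j k) *\<^sub>R b' k = w (j k)" for k
      using t(1)[of "j k"] by (simp add: b'_def)
    have nc: "(fst (n (j k)), 0, snd (n (j k))) \<in> regular_normal_cone (chain_set (gph S1) (gph S2))
        (xb + t (j k) *\<^sub>R fst (p (j k)), wb + t (j k) *\<^sub>R b' k, ub + t (j k) *\<^sub>R snd (p (j k)))" for k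
      using \<zeta>[of "j k"] by (simp add: wk x_def u_def)
    note D = directional_chain_coderivative[OF cl b1[OF wb] t(1) tj hl b' lll nc \<zeta>l]
    show ?thesis
      by (intro UN_I[OF wb] UnI1 UN_I[of "e /\<^sub>R L"] CollectI conjI D)
  next
    \<comment> \<open>The displacement of \<open>w\<close> dominates: at its own scale \<open>h\<close> and \<open>l\<close> vanish, and \<open>k = e\<close>.\<close>
    case True
    define b' where "b' = (\<lambda>k. (w (j k) - wb) /\<^sub>R \<sigma> k)"
    define a' where "a' = (\<lambda>k. (t (j k) / \<sigma> k) *\<^sub>R fst (p (j k)))"
    define c' where "c' = (\<lambda>k. (t (j k) / \<sigma> k) *\<^sub>R snd (p (j k)))"
    have e: "e \<in> sphere 0 1" using max1 True by (auto simp: max_def split: if_splits)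
    have b': "b' \<longlonglongrightarrow> e" using el by (simp add: b'_def)
    have a': "a' \<longlonglongrightarrow> 0" using tendsto_scaleR[OF Ll hl] by (simp add: a'_def True)
    have c': "c' \<longlonglongrightarrow> 0" using tendsto_scaleR[OF Ll lll] by (simp add: c'_def True)
    have nc: "(fst (n (j k)), 0, snd (n (j k))) \<in> regular_normal_cone (chain_set (gph S1) (gph S2))
        (xb + \<sigma> k *\<^sub>R a' k, wb + \<sigma> k *\<^sub>R b' k, ub + \<sigma> k *\<^sub>R c' k)" for k
      using \<zeta>[of "j k"] \<sigma>0[of k] by (simp add: a'_def b'_def c'_def x_def u_def)
    note D = directional_chain_coderivative[OF cl b2[OF wb e] \<sigma>0 \<sigma>l a' b' c' nc \<zeta>l]
    show ?thesis
      by (intro UN_I[OF wb] UnI2 UN_I[of e] CollectI conjI e D)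
  qed
qed

end
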